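(* Let $T$ be an infinitely splitting Suslin tree. Then every finitely splitting subtree of $T$ is countable.
   Context: A tree is a strict partial order $(T,<)$ in which $\{y:y<x\}$ is well-ordered for every $x$. An $\aleph_1$-tree is a tree of height $\omega_1$ with all levels countable. A Suslin tree is an $\aleph_1$-tree with no uncountable chains and no uncountable antichains. $T$ is infinitely splitting if every node of $T$ has infinitely many immediate successors. A subtree of $T$ is a downward closed subset $S\subseteq T$; it is finitely splitting if every $x\in S$ has only finitely many immediate successors in $S$. *)

theory Defs
  imports Main "HOL-Library.Countable_Set"
begin

unbundle cardinal_syntax

text \<open>
  Ordinals are represented by (reflexive) well-orders, compared with \<open>=o\<close> and \<open><o\<close>.
  A strict order on \<open>T\<close> is a relation \<open>r\<close> contained in \<open>T \<times> T\<close>, where \<open>(x, y) \<in> r\<close> means \<open>x < y\<close>.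
\<close>

abbreviation omega1 :: "nat set rel" where
  "omega1 \<equiv> cardSuc natLeq"

definition preds :: "'a rel \<Rightarrow> 'a \<Rightarrow> 'a set" where
  "preds r x = {y. (y, x) \<in> r}"

definition pred_order :: "'a rel \<Rightarrow> 'a \<Rightarrow> 'a rel" where
  "pred_order r x = Restr r (preds r x) \<union> Id_on (preds r x)"

definition is_tree :: "'a set \<Rightarrow> 'a rel \<Rightarrow> bool" where
  "is_tree T r \<longleftrightarrow> r \<subseteq> T \<times> T \<and> irrefl r \<and> trans r \<and>
     (\<forall>x\<in>T. well_order_on (preds r x) (pred_order r x))"

definition level :: "'a set \<Rightarrow> 'a rel \<Rightarrow> 'b rel \<Rightarrow> 'a set" where
  "level T r \<alpha> = {x \<in> T. pred_order r x =o \<alpha>}"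

text \<open>
  The height is the least ordinal whose level is empty. Up to isomorphism, the ordinals below
  \<open>\<alpha> :: 'b rel\<close> all occur among the well-orders of type \<open>'b rel\<close>.
\<close>

definition has_height :: "'a set \<Rightarrow> 'a rel \<Rightarrow> 'b rel \<Rightarrow> bool" where
  "has_height T r \<alpha> \<longleftrightarrow> Well_order \<alpha> \<and> level T r \<alpha> = {} \<and>
     (\<forall>\<beta>::'b rel. \<beta> <o \<alpha> \<longrightarrow> level T r \<beta> \<noteq> {})"

definition aleph1_tree :: "'a set \<Rightarrow> 'a rel \<Rightarrow> bool" where
  "aleph1_tree T r \<longleftrightarrow> is_tree T r \<and> has_height T r omega1 \<and>
     (\<forall>\<alpha>::nat set rel. \<alpha> <o omega1 \<longrightarrow> countable (level T r \<alpha>))"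

definition is_chain :: "'a set \<Rightarrow> 'a rel \<Rightarrow> 'a set \<Rightarrow> bool" where
  "is_chain T r C \<longleftrightarrow> C \<subseteq> T \<and> total_on C r"

definition is_antichain :: "'a set \<Rightarrow> 'a rel \<Rightarrow> 'a set \<Rightarrow> bool" where
  "is_antichain T r A \<longleftrightarrow> A \<subseteq> T \<and> (\<forall>x\<in>A. \<forall>y\<in>A. (x, y) \<notin> r)"

definition suslin_tree :: "'a set \<Rightarrow> 'a rel \<Rightarrow> bool" where
  "suslin_tree T r \<longleftrightarrow> aleph1_tree T r \<and>
     \<not> (\<exists>C. is_chain T r C \<and> uncountable C) \<and>
     \<not> (\<exists>A. is_antichain T r A \<and> uncountable A)"

definition imm_succs :: "'a set \<Rightarrow> 'a rel \<Rightarrow> 'a \<Rightarrow> 'a set" where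
  "imm_succs S r x = {y \<in> S. (x, y) \<in> r \<and> \<not> (\<exists>z\<in>S. (x, z) \<in> r \<and> (z, y) \<in> r)}"

definition infinitely_splitting :: "'a set \<Rightarrow> 'a rel \<Rightarrow> bool" where
  "infinitely_splitting T r \<longleftrightarrow> (\<forall>x\<in>T. infinite (imm_succs T r x))"

definition is_subtree :: "'a set \<Rightarrow> 'a set \<Rightarrow> 'a rel \<Rightarrow> bool" where
  "is_subtree S T r \<longleftrightarrow> S \<subseteq> T \<and> (\<forall>x\<in>S. \<forall>y\<in>T. (y, x) \<in> r \<longrightarrow> y \<in> S)"

text \<open>
  For a downward closed \<open>S\<close>, immediate successors computed inside \<open>S\<close> are exactly the
  immediate successors in \<open>T\<close> that lie in \<open>S\<close>.
\<close>

definition finitely_splitting :: "'a set \<Rightarrow> 'a rel \<Rightarrow> bool" where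
  "finitely_splitting S r \<longleftrightarrow> (\<forall>x\<in>S. finite (imm_succs S r x))"

end

theory Submission imports Defs begin

text \<open>
  Every node \<open>x\<close> of a finitely splitting subtree \<open>S\<close> has an immediate successor \<open>f x\<close> in \<open>T - S\<close>.
  All predecessors of \<open>f x\<close> lie in \<open>S\<close>, so the nodes \<open>f x\<close> are minimal in \<open>T - S\<close> and form an
  antichain; and \<open>x\<close> is the largest predecessor of \<open>f x\<close>, so \<open>f\<close> is injective. Hence \<open>S\<close> embeds
  into an antichain.
\<close>

lemma is_tree_preds_comparable:
  assumes "is_tree T r" and "(x, z) \<in> r" and "(y, z) \<in> r"
  shows "x = y \<or> (x, y) \<in> r \<or> (y, x) \<in> r"
proof -
  have "z \<in> T" using assms by (auto simp: is_tree_def)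
  then have "total_on (preds r z) (pred_order r z)"
    using assms(1) by (auto simp: is_tree_def well_order_on_def linear_order_on_def)
  then show ?thesis
    using assms(2,3) by (auto simp: total_on_def preds_def pred_order_def)
qed

text \<open>Both \<open>z\<close> and \<open>x\<close> lie below \<open>y\<close>, so they are
  comparable, and \<open>x < z\<close> would put \<open>z\<close> strictly between \<open>x\<close>
  and \<open>y\<close>.\<close>

lemma is_tree_below_imm_succ:
  assumes "is_tree T r" and "y \<in> imm_succs T r x" and "(z, y) \<in> r"
  shows "z = x \<or> (z, x) \<in> r"
proof -
  have "z \<in> T" using assms(1,3) by (auto simp: is_tree_def)
  then show ?thesis
    using is_tree_preds_comparable[OF assms(1), of z y x] assms(2,3)
    by (auto simp: imm_succs_def)
qed

text \<open>Passing from \<open>T\<close> to \<open>S\<close> only removes candidates for a node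
  strictly in between.\<close>

lemma imm_succs_Int_subset:
  assumes "S \<subseteq> T"
  shows "imm_succs T r x \<inter> S \<subseteq> imm_succs S r x"
  using assms by (auto simp: imm_succs_def)

theorem theorem4p12:
  fixes T :: "'a set" and r :: "'a rel"
  assumes "suslin_tree T r" and "infinitely_splitting T r"
  shows "\<forall>S. is_subtree S T r \<and> finitely_splitting S r \<longrightarrow> countable S"
proof (intro allI impI, elim conjE)
  fix S
  assume sub: "is_subtree S T r" and fin: "finitely_splitting S r"
  have tree: "is_tree T r"
    using assms(1) by (simp add: suslin_tree_def aleph1_tree_def)
  have "S \<subseteq> T" using sub by (simp add: is_subtree_def)
  have "\<exists>y. y \<in> imm_succs T r x \<and> y \<notin> S" if "x \<in> S" for x
  proof (rule ccontr)
    assume "\<not> ?thesis"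
    \<comment> \<open>An infinite set would thus sit inside a finite one.\<close>
    then have "imm_succs T r x \<subseteq> imm_succs S r x"
      using imm_succs_Int_subset[OF \<open>S \<subseteq> T\<close>] by fast
    then show False
      using that fin assms(2) \<open>S \<subseteq> T\<close> finite_subset
      by (fastforce simp: finitely_splitting_def infinitely_splitting_def)
  qed
  then obtain f where f: "f x \<in> imm_succs T r x" "f x \<notin> S" if "x \<in> S" for x
    by metis
  have fT: "f x \<in> T" and fr: "(x, f x) \<in> r" if "x \<in> S" for x
    using f(1)[OF that] by (auto simp: imm_succs_def)
  have below_in_S: "z \<in> S" if "x \<in> S" "(z, f x) \<in> r" for x z
  proof -
    have "z \<in> T" using tree that by (auto simp: is_tree_def)
    then show ?thesis
      using is_tree_below_imm_succ[OF tree f(1)[OF that(1)] that(2)] sub that(1)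
      by (auto simp: is_subtree_def)
  qed
  \<comment> \<open>If \<open>f x < f y\<close>, then \<open>below_in_S\<close> would put
    \<open>f x\<close> into \<open>S\<close>, against the choice of \<open>f\<close>.\<close>
  have "is_antichain T r (f ` S)"
    using fT f(2) below_in_S by (auto simp: is_antichain_def)
  then have "countable (f ` S)"
    using assms(1) by (auto simp: suslin_tree_def)
  moreover have "inj_on f S"
  proof (rule inj_onI)
    fix x y
    assume "x \<in> S" "y \<in> S" "f x = f y"
    \<comment> \<open>The common value is an immediate successor of both \<open>x\<close> and
      \<open>y\<close>, so each bounds the other from above.\<close>
    then have "x = y \<or> (x, y) \<in> r" "y = x \<or> (y, x) \<in> r"
      using is_tree_below_imm_succ[OF tree] f(1) fr by metis+
    then show "x = y"
      using tree unfolding is_tree_def irrefl_def by (metis transD)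
  qed
  ultimately show "countable S"
    using countable_image_inj_on by blast
qed

end
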